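(* Assume that for every odd integer $q\ge 3$ there is a real number $r_q>\frac12$ such that $r_q\le \mathrm{res}_q(N,N')$ for every negative integer $N$ and every $N'$ reached from $N$ by a non-repeating $q$-Collatz process. Let $q\ge 3$ be an odd integer, let $N$ be a negative integer, and let $N'$ be reached from $N$ by a non-repeating $q$-Collatz process with $d$ steps in total, of which $o$ are odd steps and $e$ are even steps. Then $$\begin{aligned} o&=\lceil \log_{2q}(2)\, d-\log_{2q}(N/N')\rceil,\\ e&=\lfloor \log_{2q}(q)\, d+\log_{2q}(N/N')\rfloor,\\ d&=\lfloor \log_2(2q)\, o+\log_2(N/N')\rfloor,\\ e&=\lfloor \log_2(q)\, o+\log_2(N/N')\rfloor,\\ d&=\lceil \log_q(2q)\, e-\log_q(N/N')\rceil,\\ o&=\lceil \log_q(2)\, e-\log_q(N/N')\rceil. \end{aligned}$$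
   Context: For an odd integer $q\ge 3$, the $q$-Collatz function on integers is $C_q(N)=qN+1$ if $N$ is odd and $C_q(N)=N/2$ if $N$ is even. A non-repeating $q$-Collatz process from $N$ to $N'$ with $d$ steps means $N'=C_q^{(d)}(N)$ for some integer $d\ge 0$, where the values $N,C_q(N),\dots,C_q^{(d)}(N)=N'$ are pairwise distinct. An odd step is an application of $C_q$ to an odd integer, an even step an application to an even integer; $o$ and $e$ denote the numbers of odd and even steps, so $d=o+e$. The residue is $\mathrm{res}_q(N,N')=\dfrac{2^{e}}{q^{o}\cdot \frac{N}{N'}}$. (Iterates of a negative integer under $C_q$ are negative, so $N/N'>0$.) *)

theory Defs
  imports Complex_Main
begin

definition collatz :: "int \<Rightarrow> int \<Rightarrow> int" where
  "collatz q N = (if odd N then q * N + 1 else N div 2)"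

definition nonrepeating_process :: "int \<Rightarrow> int \<Rightarrow> int \<Rightarrow> nat \<Rightarrow> bool" where
  "nonrepeating_process q N N' d \<longleftrightarrow>
     N' = (collatz q ^^ d) N \<and> inj_on (\<lambda>i. (collatz q ^^ i) N) {0..d}"

definition odd_steps :: "int \<Rightarrow> int \<Rightarrow> nat \<Rightarrow> nat" where
  "odd_steps q N d = card {i. i < d \<and> odd ((collatz q ^^ i) N)}"

definition even_steps :: "int \<Rightarrow> int \<Rightarrow> nat \<Rightarrow> nat" where
  "even_steps q N d = card {i. i < d \<and> even ((collatz q ^^ i) N)}"

lemma nonrepeating_process_steps_unique:
  assumes "nonrepeating_process q N N' d" and "nonrepeating_process q N N' d'"
  shows "d = d'"
proof -
  have *: "a = b" if "nonrepeating_process q N N' a" "nonrepeating_process q N N' b" "a \<le> b"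
    for a b
    using that unfolding nonrepeating_process_def inj_on_def by auto
  show ?thesis
    using *[of d d'] *[of d' d] assms by (cases "d \<le> d'") auto
qed

text \<open>The residue depends on the endpoints only, because the non-repeating process from
  \<open>N\<close> to \<open>N'\<close> is unique when it exists; the value is meaningful only in that case.\<close>

definition residue :: "int \<Rightarrow> int \<Rightarrow> int \<Rightarrow> real" where
  "residue q N N' =
     (let d = (THE d. nonrepeating_process q N N' d)
      in 2 ^ even_steps q N d
           / (of_int q ^ odd_steps q N d * (of_int N / of_int N')))"

lemma residue_eq:
  assumes "nonrepeating_process q N N' d"
  shows "residue q N N' =
    2 ^ even_steps q N d / (of_int q ^ odd_steps q N d * (of_int N / of_int N'))"
proof -
  have "(THE d. nonrepeating_process q N N' d) = d"
    using assms nonrepeating_process_steps_unique by blast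
  then show ?thesis
    by (simp add: residue_def Let_def)
qed

end

theory Submission
  imports Defs
begin

text \<open>On negative integers an even step halves exactly, while an odd step multiplies the absolute
  value by slightly less than \<open>q\<close>. Hence \<open>2 ^ e * \<bar>N'\<bar> \<le> q ^ o * \<bar>N\<bar>\<close>, that is, the residue is at most 1.
  Together with the assumed lower bound, the logarithm of the residue lies in \<open>(- ln 2, 0]\<close>.
  Each of the six expressions differs from the corresponding integer by this logarithm, up to sign,
  divided by \<open>ln 2\<close>, \<open>ln q\<close> or \<open>ln (2 * q)\<close>, so by an amount in \<open>[0, 1)\<close>, and rounding recovers
  the integer.\<close>

lemma odd_steps_0 [simp]: "odd_steps q N 0 = 0"
  by (simp add: odd_steps_def)

lemma even_steps_0 [simp]: "even_steps q N 0 = 0"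
  by (simp add: even_steps_def)

lemma odd_steps_Suc:
  "odd_steps q N (Suc d) = odd_steps q N d + (if odd ((collatz q ^^ d) N) then 1 else 0)"
proof -
  have "{i. i < Suc d \<and> odd ((collatz q ^^ i) N)} =
      {i. i < d \<and> odd ((collatz q ^^ i) N)} \<union> (if odd ((collatz q ^^ d) N) then {d} else {})"
    by (auto simp: less_Suc_eq)
  then show ?thesis
    by (auto simp: odd_steps_def)
qed

lemma even_steps_Suc:
  "even_steps q N (Suc d) = even_steps q N d + (if even ((collatz q ^^ d) N) then 1 else 0)"
proof -
  have "{i. i < Suc d \<and> even ((collatz q ^^ i) N)} =
      {i. i < d \<and> even ((collatz q ^^ i) N)} \<union> (if even ((collatz q ^^ d) N) then {d} else {})"
    by (auto simp: less_Suc_eq)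
  then show ?thesis
    by (auto simp: even_steps_def)
qed

lemma odd_steps_plus_even_steps: "odd_steps q N d + even_steps q N d = d"
  by (induction d) (auto simp: odd_steps_Suc even_steps_Suc)

text \<open>For odd \<open>N\<close> the bound \<open>q * N + 1 \<le> 2 * N + 1 < 0\<close> applies.
  Negativity of all iterates makes \<open>N / N'\<close> positive, so its logarithms are
  meaningful.\<close>

lemma collatz_neg:
  assumes "N < 0" "q \<ge> 2"
  shows "collatz q N < 0"
proof (cases "even N")
  case False
  have "q * N \<le> 2 * N"
    using assms by (intro mult_right_mono_neg) auto
  then have "q * N + 1 < 0"
    using \<open>N < 0\<close> by linarith
  with False show ?thesis
    by (simp add: collatz_def)
qed (use assms in \<open>auto simp: collatz_def\<close>)

lemma funpow_collatz_neg:
  assumes "N < 0" "q \<ge> 2"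
  shows "(collatz q ^^ d) N < 0"
  by (induction d) (use assms in \<open>auto intro: collatz_neg\<close>)

text \<open>Induction on the number of steps: an even step preserves the right-hand side, and an odd
  step can only push it above \<open>q\<close> times its old value. Keeping signs avoids absolute
  values.\<close>

lemma collatz_lower_bound:
  assumes "q \<ge> 0"
  shows "q ^ odd_steps q N d * N \<le> 2 ^ even_steps q N d * (collatz q ^^ d) N"
proof (induction d)
  case (Suc d)
  let ?M = "(collatz q ^^ d) N" and ?o = "odd_steps q N d" and ?e = "even_steps q N d"
  show ?case
  proof (cases "even ?M")
    case True
    then have "2 * collatz q ?M = ?M"
      by (simp add: collatz_def)
    then have M: "2 ^ ?e * ?M = 2 ^ Suc ?e * collatz q ?M"
      by simp
    from Suc[unfolded M] True show ?thesis
      by (simp add: odd_steps_Suc even_steps_Suc)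
  next
    case False
    have "q * (q ^ ?o * N) \<le> q * (2 ^ ?e * ?M)"
      using Suc assms by (intro mult_left_mono)
    \<comment> \<open>The two sides differ by \<open>2 ^ ?e\<close>, the contribution of the
      \<open>+ 1\<close> in the odd step.\<close>
    also have "\<dots> \<le> 2 ^ ?e * (q * ?M + 1)"
      by (simp add: algebra_simps)
    also have "q * ?M + 1 = collatz q ?M"
      using False by (simp add: collatz_def)
    finally show ?thesis
      using False by (simp add: odd_steps_Suc even_steps_Suc mult.assoc)
  qed
qed simp

lemma residue_le_1:
  assumes "nonrepeating_process q N N' d" "N < 0" "q \<ge> 2"
  shows "residue q N N' \<le> 1"
proof -
  define a b :: real where "a = of_int q ^ odd_steps q N d" and "b = 2 ^ even_steps q N d"
  have N': "N' = (collatz q ^^ d) N"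
    using assms(1) by (simp add: nonrepeating_process_def)
  have "N' < 0"
    unfolding N' using assms by (intro funpow_collatz_neg)
  have "q ^ odd_steps q N d * N \<le> 2 ^ even_steps q N d * N'"
    unfolding N' using assms by (intro collatz_lower_bound) auto
  then have "real_of_int (q ^ odd_steps q N d * N) \<le> of_int (2 ^ even_steps q N d * N')"
    by (simp only: of_int_le_iff)
  then have ineq: "a * of_int N \<le> b * of_int N'"
    by (simp add: a_def b_def)
  have "a > 0"
    using assms by (simp add: a_def)
  with \<open>N < 0\<close> have "a * of_int N < 0"
    by (simp add: mult_pos_neg)
  \<comment> \<open>The divisor is negative, so the inequality flips; the quotient is the
    residue.\<close>
  with ineq have "(b * of_int N') / (a * of_int N) \<le> 1"
    by (simp add: divide_le_eq)
  then show ?thesis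
    using residue_eq[OF assms(1)] by (simp add: a_def b_def)
qed

text \<open>The assumptions force \<open>y > 0\<close>, so \<open>x / y\<close> lies in
  \<open>(-1, 0]\<close>.\<close>

lemma ceiling_plus_divide:
  fixes x y :: real
  assumes "- y < x" "x \<le> 0"
  shows "\<lceil>real n + x / y\<rceil> = int n"
  using assms by (intro ceiling_unique) (auto simp: field_simps)

lemma floor_minus_divide:
  fixes x y :: real
  assumes "- y < x" "x \<le> 0"
  shows "\<lfloor>real n - x / y\<rfloor> = int n"
  using assms by (intro floor_unique) (auto simp: field_simps)

theorem theorem5p12:
  fixes q N N' :: int and d n_odd n_even :: nat
  assumes residue_bound:
      "\<forall>p::int. odd p \<and> p \<ge> 3 \<longrightarrow>
         (\<exists>r::real. r > 1 / 2 \<and>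
            (\<forall>M M'. M < 0 \<and> (\<exists>k. nonrepeating_process p M M' k) \<longrightarrow> r \<le> residue p M M'))"
    and "odd q" and "q \<ge> 3" and "N < 0"
    and "nonrepeating_process q N N' d"
    and "n_odd = odd_steps q N d" and "n_even = even_steps q N d"
  shows
    "int n_odd = \<lceil>log (2 * of_int q) 2 * real d - log (2 * of_int q) (of_int N / of_int N')\<rceil> \<and>
     int n_even = \<lfloor>log (2 * of_int q) (of_int q) * real d + log (2 * of_int q) (of_int N / of_int N')\<rfloor> \<and>
     int d = \<lfloor>log 2 (2 * of_int q) * real n_odd + log 2 (of_int N / of_int N')\<rfloor> \<and>
     int n_even = \<lfloor>log 2 (of_int q) * real n_odd + log 2 (of_int N / of_int N')\<rfloor> \<and>
     int d = \<lceil>log (of_int q) (2 * of_int q) * real n_even - log (of_int q) (of_int N / of_int N')\<rceil> \<and>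
     int n_odd = \<lceil>log (of_int q) 2 * real n_even - log (of_int q) (of_int N / of_int N')\<rceil>"
proof -
  define Q R where "Q = real_of_int q" and "R = real_of_int N / of_int N'"
  define L where "L = ln (residue q N N')"
  have Q: "Q \<ge> 3"
    using \<open>q \<ge> 3\<close> by (simp add: Q_def)
  have "N' < 0"
    using assms(3-5) by (auto simp: nonrepeating_process_def intro: funpow_collatz_neg)
  then have R: "R > 0"
    using \<open>N < 0\<close> by (simp add: R_def divide_neg_neg)
  have res_gt: "residue q N N' > 1 / 2"
    using residue_bound assms(2-5) by fastforce
  have res_le: "residue q N N' \<le> 1"
    using assms(3-5) by (intro residue_le_1) auto
  have "ln (1 / 2) < L"
    unfolding L_def using res_gt by (subst ln_less_cancel_iff) auto
  then have L_gt: "- ln 2 < L"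
    by (simp add: ln_div)
  have L_le: "L \<le> 0"
    using res_gt res_le by (simp add: L_def)
  have "residue q N N' = 2 ^ n_even / (Q ^ n_odd * R)"
    using residue_eq[OF assms(5)] assms(6,7) by (simp add: Q_def R_def)
  \<comment> \<open>The logarithm of the residue formula gives one linear relation. With
    \<open>d = n_odd + n_even\<close>, all six identities follow from it by eliminating a step count
    and dividing by the logarithm of the base.\<close>
  then have L: "n_even * ln 2 = n_odd * ln Q + ln R + L"
    using Q R by (simp add: L_def ln_div ln_mult ln_realpow)
  have d: "real d = real n_odd + real n_even"
    using odd_steps_plus_even_steps[of q N d] assms(6,7) by linarith
  have ln2Q: "ln (2 * Q) = ln 2 + ln Q"
    using Q by (simp add: ln_mult)
  have ln2: "ln 2 > (0::real)" and lnQ: "ln 2 < ln Q" and lnQ_pos: "ln Q > 0"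
    using Q by auto
  have pos: "ln (2 * Q) > 0"
    using ln2 lnQ ln2Q by linarith
  have "log (2 * Q) 2 * d - log (2 * Q) R = n_odd + L / ln (2 * Q)"
  proof -
    have "ln 2 * d - ln R = n_odd * ln (2 * Q) + L"
      unfolding d ln2Q using L by (simp add: algebra_simps)
    then show ?thesis
      using pos by (simp add: log_def add_divide_distrib flip: diff_divide_distrib)
  qed
  moreover have "log (2 * Q) Q * d + log (2 * Q) R = n_even - L / ln (2 * Q)"
  proof -
    have "ln Q * d + ln R = n_even * ln (2 * Q) - L"
      unfolding d ln2Q using L by (simp add: algebra_simps)
    then show ?thesis
      using pos by (simp add: log_def diff_divide_distrib flip: add_divide_distrib)
  qed
  moreover have "log 2 (2 * Q) * n_odd + log 2 R = d - L / ln 2"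
    unfolding log_def d ln2Q using L ln2 by (simp add: field_simps)
  moreover have "log 2 Q * n_odd + log 2 R = n_even - L / ln 2"
    using L ln2 by (simp add: log_def field_simps)
  moreover have "log Q (2 * Q) * n_even - log Q R = d + L / ln Q"
    unfolding log_def d ln2Q using L lnQ_pos by (simp add: field_simps)
  moreover have "log Q 2 * n_even - log Q R = n_odd + L / ln Q"
    using L lnQ_pos by (simp add: log_def field_simps)
  \<comment> \<open>Base 2 has the smallest logarithm of the three, so the lower bound
    \<open>1 / 2\<close> on the residue serves the bases \<open>Q\<close> and \<open>2 * Q\<close>
    as well.\<close>
  moreover have "- ln Q < L" "- ln (2 * Q) < L"
    using L_gt ln2 lnQ ln2Q by linarith+
  ultimately show ?thesis
    using L_gt L_le by (simp add: ceiling_plus_divide floor_minus_divide flip: Q_def R_def)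
qed

end
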